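(* Let $l>0$ be a real number and $0<\epsilon<0.1$. There is a function $f:\mathbb{R}\to\mathbb{R}$ with the following properties: (1) $f(x)=w_1M_{\mu_1,\sigma_1^2}(x)+\dots+w_nM_{\mu_n,\sigma_n^2}(x)$ with $n=O((\log 1/\epsilon)^2)$ and $0\le w_1,\dots,w_n\le 1$; (2) the $10\sqrt{\log 1/\epsilon}$-significant intervals of all the $M_{\mu_i,\sigma_i^2}$ are contained in $[-(1+\epsilon)l,(1+\epsilon)l]$; (3) $0\le f(x)\le 1+\epsilon$ for all $x$; (4) $1-\epsilon\le f(x)\le 1+\epsilon$ for all $x\in[-l,l]$; (5) $0\le f(x)\le\epsilon$ for $x\ge(1+\epsilon)l$ and for $x\le-(1+\epsilon)l$.
   Context: For parameters $\mu,\sigma$, the Gaussian multiplier is $M_{\mu,\sigma^2}(x)=e^{-(x-\mu)^2/(2\sigma^2)}$ (a Gaussian scaled to have maximum value $1$). For $C>0$, the $C$-significant interval of $M_{\mu,\sigma^2}$ (or of $N(\mu,\sigma^2)$) is $[\mu-C\sigma,\mu+C\sigma]$. $O(\cdot)$ hides an absolute constant. *)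

theory Defs
  imports Complex_Main
begin

text \<open>The second parameter is the standard deviation \<open>\<sigma>\<close>, not the variance, so
  \<open>gaussian_multiplier \<mu> \<sigma>\<close> is the paper's \<open>M\<close> with subscripts \<open>\<mu>\<close>, \<open>\<sigma>\<^sup>2\<close>.
  Both definitions are meant for \<open>\<sigma> > 0\<close>: for \<open>\<sigma> = 0\<close> the first is constantly 1,
  and for \<open>\<sigma> < 0\<close> the second is empty (when \<open>C > 0\<close>), so positivity of \<open>\<sigma>\<close> has to be
  stated wherever they are used.\<close>

definition gaussian_multiplier :: "real \<Rightarrow> real \<Rightarrow> real \<Rightarrow> real" where
  "gaussian_multiplier \<mu> \<sigma> x = exp (- ((x - \<mu>)\<^sup>2 / (2 * \<sigma>\<^sup>2)))"

definition significant_interval :: "real \<Rightarrow> real \<Rightarrow> real \<Rightarrow> real set" where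
  "significant_interval C \<mu> \<sigma> = {\<mu> - C * \<sigma> .. \<mu> + C * \<sigma>}"

end

theory Submission
  imports Defs "HOL-Analysis.Infinite_Sum"
begin

text \<open>Bumps \<open>B\<^sub>j = (1 / Z) * (\<Sum>\<bar>k\<bar> \<le> m\<^sub>j. exp (- s * (x / h\<^sub>j - k)\<^sup>2))\<close> with \<open>h\<^sub>j = h\<^sub>0 / 2 ^ j\<close> have edges
  that get twice as sharp at each step. Since a Gaussian is the convolution of two narrower ones,
  \<open>B\<^sub>j\<close> is nearly a combination of the Gaussians of scale \<open>h\<^sub>j\<^sub>+\<^sub>1\<close>, with coefficients nearly equal to
  those of \<open>B\<^sub>j\<^sub>+\<^sub>1\<close> except at \<open>O(log (1 / \<epsilon>))\<close> lattice points near the two edges. Hence the difference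
  \<open>B\<^sub>j\<^sub>+\<^sub>1 - B\<^sub>j\<close> costs \<open>O(log (1 / \<epsilon>))\<close> Gaussians, with nonnegative weights, and \<open>O(log (1 / \<epsilon>))\<close> steps
  bring the edge width from \<open>l\<close> down to \<open>\<epsilon> l\<close>.

  The discretisation errors are governed by the deviation of the theta function
  \<open>\<Sum>k. exp (- s * (x - k)\<^sup>2)\<close> from a constant. Instead of Poisson summation, the duplication formula
  is used: halving \<open>s\<close> squares the deviation, so \<open>s\<close> of order \<open>1 / log (1 / \<epsilon>)\<close> already gives
  a deviation of a power of \<open>\<epsilon>\<close>.\<close>

subsection \<open>The theta function\<close>

definition gauss :: "real \<Rightarrow> real \<Rightarrow> real" where
  "gauss s u = exp (- (s * u\<^sup>2))"

definition theta :: "real \<Rightarrow> real \<Rightarrow> real" where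
  "theta s x = (\<Sum>\<^sub>\<infinity>k::int. gauss s (x - of_int k))"

lemma gauss_nonneg: "0 \<le> gauss s u"
  by (simp add: gauss_def)

lemma gauss_le_1: "0 < s \<Longrightarrow> gauss s u \<le> 1"
  by (simp add: gauss_def)

lemma gauss_antimono: "0 < s \<Longrightarrow> \<bar>u\<bar> \<le> \<bar>v\<bar> \<Longrightarrow> gauss s v \<le> gauss s u"
  by (simp add: gauss_def abs_le_square_iff)

lemma gauss_minus: "gauss s (- u) = gauss s u"
  by (simp add: gauss_def)

section \<open>Summability of Gaussians over shifted integer lattices\<close>

lemma summable_on_gauss_nat:
  assumes "0 < s"
  shows "(\<lambda>n::nat. gauss s (real n)) summable_on UNIV"
proof (rule summable_on_comparison_test)
  have "norm (exp (- s)) < 1"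
    using assms by simp
  then have "summable (\<lambda>n. exp (- s) ^ n)"
    by (rule summable_geometric)
  then show "(\<lambda>n. exp (- s) ^ n) summable_on (UNIV :: nat set)"
    by (subst summable_on_UNIV_nonneg_real_iff) auto
next
  fix n :: nat
  have "real n \<le> (real n)\<^sup>2"
    by (simp add: power2_eq_square flip: of_nat_mult)
  then have "s * real n \<le> s * (real n)\<^sup>2"
    using assms by simp
  then show "gauss s (real n) \<le> exp (- s) ^ n"
    by (simp add: gauss_def mult.commute flip: exp_of_nat_mult)
qed (simp add: gauss_nonneg)

lemma summable_on_gauss_int:
  assumes "0 < s"
  shows "(\<lambda>k::int. gauss s (of_int k)) summable_on UNIV"
proof -
  have 1: "(\<lambda>k::int. gauss s (of_int k)) summable_on range int"
    using summable_on_gauss_nat[OF assms] by (subst summable_on_reindex) (auto simp: o_def)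
  have 2: "(\<lambda>k::int. gauss s (of_int k)) summable_on range (\<lambda>n. - int n)"
    using summable_on_gauss_nat[OF assms]
    by (subst summable_on_reindex) (auto simp: o_def gauss_minus inj_on_def)
  have "UNIV = range int \<union> range (\<lambda>n. - int n)"
    by (auto simp: image_iff) (metis int_cases2)
  then show ?thesis
    using summable_on_union[OF 1 2] by simp
qed

lemma summable_on_gauss:
  assumes "0 < s"
  shows "(\<lambda>k::int. gauss s (x - of_int k)) summable_on A"
proof -
  have "(\<lambda>k::int. gauss s (x - of_int k)) summable_on UNIV"
  proof (rule summable_on_comparison_test)
    show "(\<lambda>k::int. exp (s * x\<^sup>2) * gauss (s / 2) (of_int k)) summable_on UNIV"
      using assms by (intro summable_on_cmult_right summable_on_gauss_int) simp
  next
    fix k :: int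
    \<comment> \<open>Completing the square absorbs the shift at the price of halving
      \<open>s\<close>.\<close>
    have "0 \<le> (2 * x - of_int k)\<^sup>2"
      by simp
    then have "(of_int k)\<^sup>2 / 2 - x\<^sup>2 \<le> (x - of_int k)\<^sup>2"
      by (simp add: power2_eq_square algebra_simps)
    then have "s * ((of_int k)\<^sup>2 / 2 - x\<^sup>2) \<le> s * (x - of_int k)\<^sup>2"
      using assms by simp
    then show "gauss s (x - of_int k) \<le> exp (s * x\<^sup>2) * gauss (s / 2) (of_int k)"
      by (simp add: gauss_def algebra_simps flip: exp_add)
  qed (simp add: gauss_nonneg)
  then show ?thesis
    by (rule summable_on_subset) simp
qed

lemma has_sum_theta:
  assumes "0 < s"
  shows "((\<lambda>k::int. gauss s (x - of_int k)) has_sum theta s x) UNIV"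
  unfolding theta_def using summable_on_gauss[OF assms] by (rule has_sum_infsum)

lemma theta_add_of_int: "theta s (x + of_int n) = theta s x"
  unfolding theta_def
  by (rule infsum_reindex_bij_witness[where i = "\<lambda>k. k + n" and j = "\<lambda>k. k - n"])
     (auto simp: algebra_simps)

lemma theta_add_1: "theta s (x + 1) = theta s x"
  using theta_add_of_int[of s x 1] by simp

lemma sum_gauss_le_theta:
  assumes "0 < s" "finite A"
  shows "(\<Sum>k\<in>A. gauss s (x - of_int k)) \<le> theta s x"
  by (rule finite_sum_le_has_sum[OF has_sum_theta]) (use assms in \<open>auto simp: gauss_nonneg\<close>)

lemma theta_0_ge_1: "0 < s \<Longrightarrow> 1 \<le> theta s 0"
  using sum_gauss_le_theta[of s "{0}" 0] by (simp add: gauss_def)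

lemma theta_nonneg: "0 < s \<Longrightarrow> 0 \<le> theta s x"
  using sum_gauss_le_theta[of s "{}" x] by simp

text \<open>For \<open>0 \<le> t \<le> 1\<close> the points \<open>x + t - k\<close> interlace with the points \<open>x - k\<close>, and the summand
  is unimodal.\<close>

lemma theta_shift_le:
  assumes s: "0 < s" and t: "0 \<le> t" "t \<le> 1"
  shows "theta s (x + t) \<le> theta s x + 1"
proof -
  define n where "n = \<lfloor>x\<rfloor>"
  have n: "of_int n \<le> x" "x < of_int n + 1"
    unfolding n_def by linarith+
  let ?f = "\<lambda>k::int. gauss s (x - of_int k)"
  \<comment> \<open>The maximal value 1 is inserted between the terms at \<open>n\<close> and
    \<open>n + 1\<close>. The total becomes \<open>theta s x + 1\<close>, and \<open>?g\<close>
    dominates the shifted series term by term.\<close>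
  let ?g = "\<lambda>k::int. if k \<le> n then ?f k else if k = n + 1 then 1 else ?f (k - 1)"
  have sm: "?f summable_on A" for A
    by (rule summable_on_gauss[OF s])
  have "(?f has_sum (\<Sum>\<^sub>\<infinity>k\<in>{..n}. ?f k)) {..n}"
    using sm by (rule has_sum_infsum)
  then have h1: "(?g has_sum (\<Sum>\<^sub>\<infinity>k\<in>{..n}. ?f k)) {..n}"
    by (subst has_sum_cong[where g = ?f]) auto
  have h2: "(?g has_sum 1) {n + 1}"
    by (rule has_sum_finiteI) auto
  have h3: "(?g has_sum (\<Sum>\<^sub>\<infinity>k\<in>{n<..}. ?f k)) {n + 1<..}"
    by (subst has_sum_reindex_bij_witness[where i = "\<lambda>k. k + 1" and j = "\<lambda>k. k - 1" and h = ?f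
          and T = "{n<..}"]) (auto intro!: has_sum_infsum sm)
  have "(?g has_sum ((\<Sum>\<^sub>\<infinity>k\<in>{..n}. ?f k) + 1 + (\<Sum>\<^sub>\<infinity>k\<in>{n<..}. ?f k))) ({..n} \<union> {n + 1} \<union> {n + 1<..})"
    by (intro has_sum_Un_disjoint h1 h2 h3) auto
  moreover have "{..n} \<union> {n + 1} \<union> {n + 1<..} = UNIV"
    by auto
  moreover have "theta s x = (\<Sum>\<^sub>\<infinity>k\<in>{..n} \<union> {n<..}. ?f k)"
    unfolding theta_def by (rule arg_cong[where f = "infsum _"]) auto
  then have "theta s x = (\<Sum>\<^sub>\<infinity>k\<in>{..n}. ?f k) + (\<Sum>\<^sub>\<infinity>k\<in>{n<..}. ?f k)"
    by (subst (asm) infsum_Un_disjoint) (auto intro!: sm)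
  ultimately have "(?g has_sum (theta s x + 1)) UNIV"
    by (simp add: algebra_simps)
  with has_sum_theta[OF s] show ?thesis
  proof (rule has_sum_mono)
    fix k :: int
    consider "k \<le> n" | "k = n + 1" | "n + 2 \<le> k"
      by linarith
    then show "gauss s (x + t - of_int k) \<le> ?g k"
    proof cases
      case 1
      then have "real_of_int k \<le> of_int n"
        by simp
      then show ?thesis
        using 1 n t by (auto intro!: gauss_antimono s)
    next
      case 2
      then show ?thesis
        by (simp add: gauss_le_1 s)
    next
      case 3
      then have "real_of_int n + 2 \<le> of_int k"
        by linarith
      then show ?thesis
        using 3 n t by (auto intro!: gauss_antimono s)
    qed
  qed
qed

text \<open>Periodicity reduces two arbitrary points to a shift in [0, 1). The bound does not depend
  on \<open>s\<close>, so it can start the recursions below.\<close>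

lemma abs_theta_diff_le_1:
  assumes s: "0 < s"
  shows "\<bar>theta s x - theta s y\<bar> \<le> 1"
proof -
  have "theta s x \<le> theta s y + 1" for x y
  proof -
    define t where "t = frac (x - y)"
    have x: "x = (y + t) + of_int \<lfloor>x - y\<rfloor>"
      by (simp add: t_def frac_def)
    have "theta s x = theta s (y + t)"
      by (subst x) (rule theta_add_of_int)
    also have "\<dots> \<le> theta s y + 1"
      by (rule theta_shift_le) (use s in \<open>auto simp: t_def intro: less_imp_le frac_lt_1\<close>)
    finally show ?thesis .
  qed
  from this[of x y] this[of y x] show ?thesis
    by linarith
qed

section \<open>Products of theta series: duplication and scaling\<close>

lemma has_sum_times:
  fixes f :: "'a \<Rightarrow> real" and g :: "'b \<Rightarrow> real"
  assumes f: "(f has_sum a) A" and g: "(g has_sum b) B"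
    and nonneg: "\<And>x. 0 \<le> f x" "\<And>y. 0 \<le> g y"
  shows "((\<lambda>(x, y). f x * g y) has_sum (a * b)) (A \<times> B)"
proof -
  have 1: "((\<lambda>y. case (x, y) of (x, y) \<Rightarrow> f x * g y) has_sum f x * b) B" for x
    using has_sum_cmult_right[OF g] by simp
  have 2: "((\<lambda>x. f x * b) has_sum a * b) A"
    by (rule has_sum_cmult_left[OF f])
  have "(\<lambda>(x, y). f x * g y) summable_on A \<times> B"
    by (rule summable_on_SigmaI[OF 1])
       (use 2 nonneg in \<open>auto intro: has_sum_imp_summable mult_nonneg_nonneg\<close>)
  then have *: "((\<lambda>(x, y). f x * g y) has_sum (\<Sum>\<^sub>\<infinity>(x, y)\<in>A \<times> B. f x * g y)) (A \<times> B)"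
    by (rule has_sum_infsum)
  from has_sum_Sigma'[OF * 1] have "(\<Sum>\<^sub>\<infinity>(x, y)\<in>A \<times> B. f x * g y) = a * b"
    using 2 has_sum_unique by blast
  with * show ?thesis
    by simp
qed

text \<open>The duplication formula behind the arithmetic-geometric mean: substitute
  \<open>(k, l) = (p + q, p - q)\<close> for \<open>k + l\<close> even and \<open>(k, l) = (p + q - 1, p - q)\<close> for \<open>k + l\<close> odd.\<close>

lemma theta_mult_theta:
  assumes s: "0 < s"
  shows "theta s (u + v) * theta s (u - v) =
    theta (2 * s) u * theta (2 * s) v + theta (2 * s) (u + 1 / 2) * theta (2 * s) (v + 1 / 2)"
proof -
  let ?h = "\<lambda>(k::int, l::int). gauss s (u + v - of_int k) * gauss s (u - v - of_int l)"
  let ?h' = "\<lambda>c (p::int, q::int). gauss (2 * s) (u + c - of_int p) * gauss (2 * s) (v + c - of_int q)"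
  let ?E = "{(k::int, l::int). even (k + l)}" and ?O = "{(k::int, l::int). odd (k + l)}"
  have s2: "0 < 2 * s"
    using s by simp
  have h': "(?h' c has_sum theta (2 * s) (u + c) * theta (2 * s) (v + c)) (UNIV \<times> UNIV)" for c
    by (intro has_sum_times has_sum_theta s2 gauss_nonneg)
  \<comment> \<open>The parallelogram law for the exponents.\<close>
  have gauss: "gauss s (a + b) * gauss s (a - b) = gauss (2 * s) a * gauss (2 * s) b" for a b
    by (simp add: gauss_def power2_eq_square algebra_simps flip: exp_add)
  have e: "(?h has_sum theta (2 * s) u * theta (2 * s) v) ?E"
  proof (subst has_sum_reindex_bij_witness[where T = "UNIV \<times> UNIV" and h = "?h' 0"
        and j = "\<lambda>(k, l). ((k + l) div 2, (k - l) div 2)" and i = "\<lambda>(p, q). (p + q, p - q)"])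
    show "(?h' 0 has_sum theta (2 * s) u * theta (2 * s) v) (UNIV \<times> UNIV)"
      using h'[of 0] by simp
    fix a :: "int \<times> int" assume "a \<in> ?E"
    then obtain k l where a: "a = (k, l)" "even (k + l)"
      by auto
    then have "even (k - l)"
      by simp
    with a obtain p q where pq: "k + l = 2 * p" "k - l = 2 * q"
      by (metis dvdE)
    then have kl: "k = p + q" "l = p - q"
      by auto
    show "(case case a of (k, l) \<Rightarrow> ((k + l) div 2, (k - l) div 2) of (p, q) \<Rightarrow> (p + q, p - q)) = a"
      by (simp add: a kl)
    show "?h' 0 (case a of (k, l) \<Rightarrow> ((k + l) div 2, (k - l) div 2)) = ?h a"
      using gauss[of "u - of_int p" "v - of_int q"] by (simp add: a kl algebra_simps)
  qed (auto simp: algebra_simps)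
  have o: "(?h has_sum theta (2 * s) (u + 1 / 2) * theta (2 * s) (v + 1 / 2)) ?O"
  proof (subst has_sum_reindex_bij_witness[where T = "UNIV \<times> UNIV" and h = "?h' (1 / 2)"
        and j = "\<lambda>(k, l). ((k + l + 1) div 2, (k - l + 1) div 2)" and i = "\<lambda>(p, q). (p + q - 1, p - q)"])
    show "(?h' (1 / 2) has_sum theta (2 * s) (u + 1 / 2) * theta (2 * s) (v + 1 / 2)) (UNIV \<times> UNIV)"
      using h'[of "1 / 2"] by simp
    fix a :: "int \<times> int" assume "a \<in> ?O"
    then obtain k l where a: "a = (k, l)" "odd (k + l)"
      by auto
    then have "even (k + l + 1)" "even (k - l + 1)"
      by auto
    then obtain p q where pq: "k + l + 1 = 2 * p" "k - l + 1 = 2 * q"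
      by (metis dvdE)
    then have kl: "k = p + q - 1" "l = p - q"
      by auto
    show "?h' (1 / 2) (case a of (k, l) \<Rightarrow> ((k + l + 1) div 2, (k - l + 1) div 2)) = ?h a"
      using gauss[of "u + 1 / 2 - of_int p" "v + 1 / 2 - of_int q"] by (simp add: a kl algebra_simps)
    show "(case case a of (k, l) \<Rightarrow> ((k + l + 1) div 2, (k - l + 1) div 2) of (p, q) \<Rightarrow> (p + q - 1, p - q)) = a"
      by (simp add: a kl)
  qed (auto simp: algebra_simps)
  have "(?h has_sum theta (2 * s) u * theta (2 * s) v
      + theta (2 * s) (u + 1 / 2) * theta (2 * s) (v + 1 / 2)) (?E \<union> ?O)"
    by (rule has_sum_Un_disjoint[OF e o]) auto
  moreover have "?E \<union> ?O = UNIV \<times> UNIV"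
    by auto
  moreover have "(?h has_sum theta s (u + v) * theta s (u - v)) (UNIV \<times> UNIV)"
    by (intro has_sum_times has_sum_theta s gauss_nonneg)
  ultimately show ?thesis
    using has_sum_unique by metis
qed

text \<open>The integers and their translate by 1/2 together form the half integers; doubling maps
  these onto the integers and turns \<open>s\<close> into \<open>s / 4\<close>.\<close>

lemma theta_add_theta_half:
  assumes s: "0 < s"
  shows "theta s x + theta s (x + 1 / 2) = theta (s / 4) (2 * x)"
proof -
  let ?h = "\<lambda>k::int. gauss (s / 4) (2 * x - of_int k)"
  have gauss: "gauss (s / 4) (2 * u) = gauss s u" for u
    by (simp add: gauss_def power2_eq_square)
  have e: "(?h has_sum theta s x) {k. even k}"
  proof (subst has_sum_reindex_bij_witness[where T = UNIV and h = "\<lambda>k. gauss s (x - of_int k)"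
        and j = "\<lambda>k. k div 2" and i = "\<lambda>k. 2 * k"])
    fix k :: int assume "k \<in> {k. even k}"
    then obtain p where "k = 2 * p"
      by auto
    then show "gauss s (x - of_int (k div 2)) = ?h k"
      using gauss[of "x - of_int p"] by (simp add: algebra_simps)
  qed (auto simp: has_sum_theta s)
  have o: "(?h has_sum theta s (x + 1 / 2)) {k. odd k}"
  proof (subst has_sum_reindex_bij_witness[where T = UNIV and h = "\<lambda>k. gauss s (x + 1 / 2 - of_int k)"
        and j = "\<lambda>k. (k + 1) div 2" and i = "\<lambda>k. 2 * k - 1"])
    fix k :: int assume "k \<in> {k. odd k}"
    then have "even (k + 1)"
      by simp
    then obtain p where "k + 1 = 2 * p"
      by (rule evenE)
    then have k: "k = 2 * p - 1"
      by simp
    show "2 * ((k + 1) div 2) - 1 = k"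
      by (simp add: k)
    show "gauss s (x + 1 / 2 - of_int ((k + 1) div 2)) = ?h k"
      using gauss[of "x + 1 / 2 - of_int p"] by (simp add: k algebra_simps)
  qed (auto simp: has_sum_theta s)
  have "(?h has_sum theta s x + theta s (x + 1 / 2)) ({k. even k} \<union> {k. odd k})"
    by (rule has_sum_Un_disjoint[OF e o]) auto
  moreover have "{k::int. even k} \<union> {k. odd k} = UNIV"
    by auto
  moreover have "(?h has_sum theta (s / 4) (2 * x)) UNIV"
    by (rule has_sum_theta) (use s in simp)
  ultimately show ?thesis
    using has_sum_unique by metis
qed

text \<open>By duplication the squares of the two sides are \<open>2ab\<close> and
  \<open>a^2 + b^2\<close>, where \<open>a\<close> and \<open>b\<close> are the values of
  \<open>theta (2 * s)\<close> at 1/2 and 0.\<close>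

lemma theta_half_le:
  assumes "0 < s"
  shows "theta s (1 / 2) \<le> theta s 0"
proof -
  let ?a = "theta (2 * s) 0" and ?b = "theta (2 * s) (1 / 2)"
  have 1: "theta s 0 * theta s 0 = ?a * ?a + ?b * ?b"
    using theta_mult_theta[OF assms, of 0 0] by simp
  have 2: "theta s (1 / 2) * theta s (1 / 2) = ?a * ?b + ?b * ?a"
    using theta_mult_theta[OF assms, of "1 / 2" 0] theta_add_1[of "2 * s" 0] by simp
  have "0 \<le> (?a - ?b)\<^sup>2"
    by simp
  then have "(theta s (1 / 2))\<^sup>2 \<le> (theta s 0)\<^sup>2"
    using 1 2 by (simp add: power2_eq_square algebra_simps)
  then show ?thesis
    using theta_nonneg[OF assms] by (simp add: power_mono_iff)
qed

lemma theta_quarter_le: "0 < s \<Longrightarrow> theta (s / 4) 0 \<le> 2 * theta s 0"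
  using theta_add_theta_half[of s 0] theta_half_le[of s] by simp

section \<open>Quadratic decay of the deviation of theta from a constant\<close>

text \<open>Quadratic convergence: halving \<open>s\<close> squares the relative deviation from \<open>1/2\<close>-periodicity,
  because \<open>theta s x * theta s 0 - theta s (x + 1/2) * theta s (1/2)\<close> is the square of
  \<open>theta (2 * s) (x/2) - theta (2 * s) (x/2 + 1/2)\<close>.\<close>

lemma theta_half_shift_square:
  assumes s: "0 < s"
    and D: "\<And>x. \<bar>theta (2 * s) x - theta (2 * s) (x + 1 / 2)\<bar> \<le> D * theta (2 * s) 0"
  shows "\<bar>theta s x - theta s (x + 1 / 2)\<bar> \<le> D\<^sup>2 * theta s 0"
proof -
  let ?z = "theta s 0" and ?a = "theta (2 * s)"
  have z: "0 < ?z" "theta s (1 / 2) \<le> ?z"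
    using theta_0_ge_1[OF s] theta_half_le[OF s] by auto
  have zz: "(?a 0)\<^sup>2 \<le> ?z\<^sup>2"
    using theta_mult_theta[OF s, of 0 0] by (simp add: power2_eq_square)
  have "theta s x - theta s (x + 1 / 2) \<le> D\<^sup>2 * ?z" for x
  proof -
    have 1: "theta s x * ?z = ?a (x / 2) * ?a (x / 2) + ?a (x / 2 + 1 / 2) * ?a (x / 2 + 1 / 2)"
      using theta_mult_theta[OF s, of "x / 2" "x / 2"] by simp
    have 2: "theta s (x + 1 / 2) * theta s (1 / 2) = 2 * (?a (x / 2) * ?a (x / 2 + 1 / 2))"
      using theta_mult_theta[OF s, of "x / 2 + 1 / 2" "x / 2"] theta_add_1[of "2 * s" "x / 2"]
      by (simp add: algebra_simps)
    \<comment> \<open>Replacing one factor \<open>?z\<close> by the smaller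
      \<open>theta s (1 / 2)\<close> makes the right side a perfect square.\<close>
    have "(theta s x - theta s (x + 1 / 2)) * ?z \<le> theta s x * ?z - theta s (x + 1 / 2) * theta s (1 / 2)"
      using mult_left_mono[OF z(2) theta_nonneg[OF s, of "x + 1 / 2"]] by (simp add: algebra_simps)
    also have "\<dots> = (?a (x / 2) - ?a (x / 2 + 1 / 2))\<^sup>2"
      unfolding 1 2 by (simp add: power2_eq_square algebra_simps)
    also have "\<dots> \<le> (D * ?a 0)\<^sup>2"
      using D[of "x / 2"] by (simp add: abs_le_square_iff[symmetric])
    also have "\<dots> \<le> D\<^sup>2 * ?z\<^sup>2"
      using zz by (simp add: power_mult_distrib mult_left_mono)
    finally have "(theta s x - theta s (x + 1 / 2)) * ?z \<le> (D\<^sup>2 * ?z) * ?z"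
      by (simp add: power2_eq_square mult.assoc)
    then show ?thesis
      using z by simp
  qed
  from this[of x] this[of "x + 1 / 2"] show ?thesis
    using theta_add_1[of s x] by (simp add: algebra_simps abs_le_iff)
qed

text \<open>Squaring \<open>m\<close> times, starting from relative deviation 1/2 for
  \<open>s\<close> at most 1/2.\<close>

lemma theta_half_shift:
  assumes "0 < s" "s \<le> 1 / (2 * 2 ^ m)"
  shows "\<bar>theta s x - theta s (x + 1 / 2)\<bar> \<le> (1 / 2) ^ (2 ^ m) * theta s 0"
  using assms
proof (induction m arbitrary: s x)
  case 0
  \<comment> \<open>The terms at -1, 0, 1 already sum to at least 2, so the absolute bound 1 is at
    most half of \<open>theta s 0\<close>.\<close>
  have "1 + (- s) \<le> exp (- s)"
    by (rule exp_ge_add_one_self)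
  then have "1 / 2 \<le> gauss s 1"
    using 0 by (simp add: gauss_def)
  then have "2 \<le> (\<Sum>k\<in>{-1, 0, 1}. gauss s (0 - of_int k))"
    by (simp add: gauss_def)
  also have "\<dots> \<le> theta s 0"
    by (rule sum_gauss_le_theta) (use 0 in auto)
  finally show ?case
    using abs_theta_diff_le_1[OF 0(1), of x "x + 1 / 2"] by simp
next
  case (Suc m)
  have "\<bar>theta s x - theta s (x + 1 / 2)\<bar> \<le> ((1 / 2) ^ 2 ^ m)\<^sup>2 * theta s 0"
    by (rule theta_half_shift_square[OF Suc.prems(1)], rule Suc.IH) (use Suc.prems in \<open>auto simp: field_simps\<close>)
  then show ?case
    by (simp add: mult.commute[of 2] flip: power_mult)
qed

text \<open>From half shifts to all shifts: \<open>theta s x\<close> is half of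
  \<open>theta (s / 4) (2 * x)\<close> up to half of a half-shift difference. Passing to
  \<open>s / 4\<close> thus halves the additive error, which starts at the absolute bound 1.\<close>

lemma theta_deviation_step:
  assumes s: "0 < s" and D: "0 \<le> D" "D \<le> 1 / 2"
    and shift: "\<And>x. \<bar>theta s x - theta s (x + 1 / 2)\<bar> \<le> D * theta s 0"
  shows "\<bar>theta s x - theta s 0\<bar> \<le> 2 * D * theta s 0 + (1 / 2) ^ n"
  using assms
proof (induction n arbitrary: s D x)
  case 0
  then have "0 \<le> 2 * D * theta s 0"
    by (intro mult_nonneg_nonneg theta_nonneg) auto
  then show ?case
    using abs_theta_diff_le_1[OF 0(1), of x 0] by simp
next
  case (Suc n)
  note s = Suc.prems(1) and D = Suc.prems(2,3) and shift = Suc.prems(4)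
  have shift2: "\<bar>theta (s / 2) x - theta (s / 2) (x + 1 / 2)\<bar> \<le> D\<^sup>2 * theta (s / 2) 0" for x
    by (rule theta_half_shift_square) (use s shift in auto)
  have shift4: "\<bar>theta (s / 4) x - theta (s / 4) (x + 1 / 2)\<bar> \<le> (D\<^sup>2)\<^sup>2 * theta (s / 4) 0" for x
    by (rule theta_half_shift_square) (use s shift2 in auto)
  have "D\<^sup>2 \<le> D * (1 / 2)"
    unfolding power2_eq_square by (rule mult_left_mono) (use D in auto)
  then have D2: "D\<^sup>2 \<le> D / 2"
    by simp
  \<comment> \<open>Two squarings give \<open>D^4\<close>, at most \<open>D / 8\<close>. This
    outweighs the possible doubling of the theta value at 0, so the recursion closes with the same
    constant 2.\<close>
  have "(D\<^sup>2)\<^sup>2 \<le> (D / 2)\<^sup>2"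
    using D2 by (rule power_mono) simp
  then have D4: "(D\<^sup>2)\<^sup>2 \<le> D / 8"
    using D2 by (simp add: power2_eq_square)
  have "\<bar>theta (s / 4) (2 * x) - theta (s / 4) 0\<bar> \<le> 2 * (D\<^sup>2)\<^sup>2 * theta (s / 4) 0 + (1 / 2) ^ n"
    by (rule Suc.IH) (use s D D4 shift4 in auto)
  also have "2 * (D\<^sup>2)\<^sup>2 * theta (s / 4) 0 \<le> 2 * (D / 8) * (2 * theta s 0)"
    by (intro mult_mono theta_quarter_le) (use s D D4 theta_nonneg[of "s / 4" 0] in auto)
  finally have "\<bar>theta (s / 4) (2 * x) - theta (s / 4) 0\<bar> \<le> D * theta s 0 / 2 + (1 / 2) ^ n"
    by simp
  moreover have "theta s x + theta s (x + 1 / 2) = theta (s / 4) (2 * x)"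
    "theta s 0 + theta s (0 + 1 / 2) = theta (s / 4) 0" using theta_add_theta_half[OF s, of x] theta_add_theta_half[OF s, of 0] by auto
  moreover have "0 \<le> D * theta s 0"
    using D s by (intro mult_nonneg_nonneg theta_nonneg) auto
  ultimately show ?case
    using shift[of x] shift[of 0] unfolding power_Suc mult.assoc by linarith
qed

text \<open>The depth \<open>n\<close> in \<open>theta_deviation_step\<close> is arbitrary; its
  limit removes the additive error.\<close>

lemma theta_deviation:
  assumes s: "0 < s" "s \<le> 1 / (2 * 2 ^ m)"
  shows "\<bar>theta s x - theta s 0\<bar> \<le> 2 * (1 / 2) ^ (2 ^ m) * theta s 0"
proof (rule LIMSEQ_le_const)
  have "(1 / 2 :: real) ^ (2 ^ m) \<le> (1 / 2) ^ 1"
    by (rule power_decreasing) auto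
  then show "\<exists>N. \<forall>n\<ge>N. \<bar>theta s x - theta s 0\<bar> \<le> 2 * (1 / 2) ^ (2 ^ m) * theta s 0 + (1 / 2) ^ n"
    by (intro exI allI impI theta_deviation_step theta_half_shift s) auto
  have "(\<lambda>n. (1 / 2 :: real) ^ n) \<longlonglongrightarrow> 0"
    by (rule LIMSEQ_power_zero) simp
  then show "(\<lambda>n. 2 * (1 / 2) ^ (2 ^ m) * theta s 0 + (1 / 2) ^ n) \<longlonglongrightarrow> 2 * (1 / 2) ^ (2 ^ m) * theta s 0"
    using tendsto_add[OF tendsto_const] by fastforce
qed

text \<open>Split \<open>s\<close> into \<open>3 * s / 4\<close>, which yields the exponential
  factor, and \<open>s / 4\<close>, whose full series is at most \<open>1 + 2 * theta s 0\<close>.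
  The bound is thus relative to \<open>theta s 0\<close>, like the deviation bounds.\<close>

lemma gauss_tail:
  assumes s: "0 < s" and R: "0 \<le> R" and A: "\<And>k. k \<in> A \<Longrightarrow> R \<le> \<bar>x - of_int k\<bar>"
  shows "(\<Sum>\<^sub>\<infinity>k\<in>A. gauss s (x - of_int k)) \<le> 3 * exp (- (3 / 4 * s * R\<^sup>2)) * theta s 0"
proof -
  let ?e = "exp (- (3 / 4 * s * R\<^sup>2))"
  have s4: "0 < s / 4"
    using s by simp
  have "(\<Sum>\<^sub>\<infinity>k\<in>A. gauss s (x - of_int k)) \<le> (\<Sum>\<^sub>\<infinity>k. ?e * gauss (s / 4) (x - of_int k))"
  proof (rule infsum_mono_neutral)
    fix k assume "k \<in> A \<inter> UNIV"
    then have "R\<^sup>2 \<le> (x - of_int k)\<^sup>2"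
      using A R by (auto intro!: abs_le_square_iff[THEN iffD1])
    then have "s * R\<^sup>2 \<le> s * (x - of_int k)\<^sup>2"
      using s by simp
    then show "gauss s (x - of_int k) \<le> ?e * gauss (s / 4) (x - of_int k)"
      by (simp add: gauss_def flip: exp_add)
  qed (use s s4 in \<open>auto intro!: summable_on_gauss summable_on_cmult_right mult_nonneg_nonneg gauss_nonneg\<close>)
  also have "\<dots> = ?e * theta (s / 4) x"
    unfolding theta_def by (rule infsum_cmult_right')
  also have "theta (s / 4) x \<le> 3 * theta s 0"
    using abs_theta_diff_le_1[OF s4, of x 0] theta_quarter_le[OF s] theta_0_ge_1[OF s] by linarith
  finally show ?thesis
    by simp
qed

subsection \<open>Refining a bump\<close>

lemma has_sum_sum_finite:
  fixes f :: "'b \<Rightarrow> 'a \<Rightarrow> real"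
  assumes "\<And>k. k \<in> K \<Longrightarrow> (f k has_sum S k) A"
  shows "((\<lambda>x. \<Sum>k\<in>K. f k x) has_sum (\<Sum>k\<in>K. S k)) A"
  using assms by (induction K rule: infinite_finite_induct) (auto intro!: has_sum_add)

lemma window_sum_outside:
  assumes s: "0 < s" and x: "real m + real R \<le> \<bar>x\<bar>"
  shows "(\<Sum>k = - int m..int m. gauss s (x - of_int k)) \<le> 3 * exp (- (3 / 4 * s * (real R)\<^sup>2)) * theta s 0"
proof -
  have "real R \<le> \<bar>x - of_int k\<bar>" if "k \<in> {- int m..int m}" for k
  proof -
    have "\<bar>real_of_int k\<bar> \<le> real m"
      using that by auto
    with x show ?thesis
      by linarith
  qed
  then have "(\<Sum>\<^sub>\<infinity>k\<in>{- int m..int m}. gauss s (x - of_int k))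
      \<le> 3 * exp (- (3 / 4 * s * (real R)\<^sup>2)) * theta s 0"
    by (intro gauss_tail s) auto
  then show ?thesis
    by simp
qed

lemma window_sum_inside:
  assumes s: "0 < s" and x: "\<bar>x\<bar> + real R \<le> real m"
  shows "theta s x \<le> (\<Sum>k = - int m..int m. gauss s (x - of_int k))
    + 3 * exp (- (3 / 4 * s * (real R)\<^sup>2)) * theta s 0"
proof -
  let ?f = "\<lambda>k::int. gauss s (x - of_int k)"
  let ?A = "{- int m..int m}"
  have "real R \<le> \<bar>x - of_int k\<bar>" if "k \<in> - ?A" for k
  proof -
    have "real m \<le> \<bar>real_of_int k\<bar>"
      using that by auto
    with x show ?thesis
      by linarith
  qed
  then have "infsum ?f (- ?A) \<le> 3 * exp (- (3 / 4 * s * (real R)\<^sup>2)) * theta s 0"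
    by (intro gauss_tail s) auto
  moreover have "theta s x = infsum ?f (?A \<union> - ?A)"
    by (simp add: theta_def)
  then have "theta s x = sum ?f ?A + infsum ?f (- ?A)"
    by (subst (asm) infsum_Un_disjoint) (auto intro!: summable_on_gauss s)
  ultimately show ?thesis
    by simp
qed

text \<open>A Gaussian is the convolution of two narrower ones; discretised on the lattice of half
  integers, the constant becomes a value of \<open>theta\<close>.\<close>

lemma has_sum_gauss_refine:
  assumes s: "0 < s"
  shows "((\<lambda>i::int. gauss (4 * s / 3) (of_int i / 2 - k) * gauss s (2 * t - of_int i)) has_sum
    gauss s (t - k) * theta (4 * s / 3) ((k + 3 * t) / 2)) UNIV"
proof -
  \<comment> \<open>Completing the square in \<open>i\<close>. In the variable \<open>t\<close> the
    fine Gaussian has parameter \<open>4 * s\<close>, and \<open>4 * s / 3\<close> is forced by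
    additivity of variances: \<open>1/s = 1/(4s) + 3/(4s)\<close>.\<close>
  have "gauss (4 * s / 3) (of_int i / 2 - k) * gauss s (2 * t - of_int i) =
      gauss s (t - k) * gauss (4 * s / 3) ((k + 3 * t) / 2 - of_int i)" for i
    by (simp add: gauss_def power2_eq_square field_simps flip: exp_add)
  moreover have "0 < 4 * s / 3"
    using s by simp
  ultimately show ?thesis
    by (simp only:) (intro has_sum_cmult_right has_sum_theta)
qed

text \<open>One error unit \<open>d\<close> controls the theta deviation at both parameters of the
  refinement identity and the tails beyond radius \<open>R\<close>.\<close>

locale gauss_scale =
  fixes s d :: real and R :: nat
  assumes s_pos: "0 < s" and d_nonneg: "0 \<le> d" and d_small: "10 * d \<le> 1"
    and dev: "\<And>x. \<bar>theta s x - theta s 0\<bar> \<le> 2 * d * theta s 0"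
    and dev': "\<And>x. \<bar>theta (4 * s / 3) x - theta (4 * s / 3) 0\<bar> \<le> 2 * d * theta (4 * s / 3) 0"
    and exp_R: "exp (- (3 / 4 * s * (real R)\<^sup>2)) \<le> d"
begin

abbreviation "Z \<equiv> theta s 0"
abbreviation "Z' \<equiv> theta (4 * s / 3) 0"

lemma s'_pos: "0 < 4 * s / 3"
  using s_pos by simp

lemma Z_ge_1: "1 \<le> Z" and Z'_ge_1: "1 \<le> Z'"
  using theta_0_ge_1 s_pos s'_pos by auto

lemma exp_R': "exp (- (3 / 4 * (4 * s / 3) * (real R)\<^sup>2)) \<le> d"
proof -
  have "0 \<le> s * (real R)\<^sup>2"
    using s_pos by simp
  then have "exp (- (3 / 4 * (4 * s / 3) * (real R)\<^sup>2)) \<le> exp (- (3 / 4 * s * (real R)\<^sup>2))"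
    by simp
  with exp_R show ?thesis
    by linarith
qed

definition bump :: "nat \<Rightarrow> real \<Rightarrow> real" where
  "bump m t = (\<Sum>k = - int m..int m. gauss s (t - of_int k)) / Z"

text \<open>The coefficient of the fine Gaussian centred at \<open>i / 2\<close> in the expansion of \<open>bump m\<close>.\<close>

definition coarse :: "nat \<Rightarrow> int \<Rightarrow> real" where
  "coarse m i = (\<Sum>k = - int m..int m. gauss (4 * s / 3) (of_int i / 2 - of_int k)) / Z'"

text \<open>The half-integer points, indexed by \<open>i\<close>, near the two edges, where
  \<open>coarse\<close> is in transition. The outer end is the half-width of the next bump.\<close>

definition rim :: "nat \<Rightarrow> int set" where
  "rim m = {i. 2 * int m - 2 * int R < \<bar>i\<bar> \<and> \<bar>i\<bar> \<le> 2 * int m + 2 * int R}"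

text \<open>\<open>coarse\<close> may exceed 1 by up to \<open>2 * d\<close>; truncation at 0 keeps
  the weights nonnegative at that cost.\<close>

definition rim_weight :: "nat \<Rightarrow> int \<Rightarrow> real" where
  "rim_weight m i = max 0 (1 - coarse m i) / Z"

definition rim_sum :: "nat \<Rightarrow> real \<Rightarrow> real" where
  "rim_sum m t = (\<Sum>i\<in>rim m. rim_weight m i * gauss s (2 * t - of_int i))"

section \<open>Bounds for bumps and refinement coefficients\<close>

lemma theta_bounds: "(1 - 2 * d) * Z \<le> theta s x" "theta s x \<le> (1 + 2 * d) * Z"
  using dev[of x] by (auto simp: abs_le_iff algebra_simps)

lemma theta_bounds': "(1 - 2 * d) * Z' \<le> theta (4 * s / 3) x" "theta (4 * s / 3) x \<le> (1 + 2 * d) * Z'"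
  using dev'[of x] by (auto simp: abs_le_iff algebra_simps)

lemma bump_le: "bump m t \<le> 1 + 2 * d"
  using Z_ge_1 order.trans[OF sum_gauss_le_theta[OF s_pos] theta_bounds(2)]
  by (simp add: bump_def divide_le_eq)

text \<open>Of the loss \<open>5 * d\<close>, the theta deviation accounts for \<open>2 * d\<close>
  and the missing tail for \<open>3 * d\<close>.\<close>

lemma bump_inside:
  assumes "\<bar>t\<bar> + real R \<le> real m"
  shows "1 - 5 * d \<le> bump m t"
proof -
  have "3 * exp (- (3 / 4 * s * (real R)\<^sup>2)) * Z \<le> 3 * d * Z"
    using exp_R Z_ge_1 by (intro mult_right_mono) auto
  with window_sum_inside[OF s_pos assms] theta_bounds(1)[of t]
  have "(1 - 5 * d) * Z \<le> (\<Sum>k = - int m..int m. gauss s (t - of_int k))"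
    by (simp add: algebra_simps)
  then show ?thesis
    using Z_ge_1 by (simp add: bump_def le_divide_eq)
qed

lemma bump_outside:
  assumes "real m + real R \<le> \<bar>t\<bar>"
  shows "bump m t \<le> 3 * d"
proof -
  have "3 * exp (- (3 / 4 * s * (real R)\<^sup>2)) * Z \<le> 3 * d * Z"
    using exp_R Z_ge_1 by (intro mult_right_mono) auto
  with window_sum_outside[OF s_pos assms]
  have "(\<Sum>k = - int m..int m. gauss s (t - of_int k)) \<le> 3 * d * Z"
    by linarith
  then show ?thesis
    using Z_ge_1 by (simp add: bump_def divide_le_eq)
qed

lemma coarse_nonneg: "0 \<le> coarse m i"
  using Z'_ge_1 by (auto simp: coarse_def intro!: divide_nonneg_nonneg sum_nonneg gauss_nonneg)

lemma coarse_le: "coarse m i \<le> 1 + 2 * d"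
  using Z'_ge_1 order.trans[OF sum_gauss_le_theta[OF s'_pos] theta_bounds'(2)]
  by (simp add: coarse_def divide_le_eq)

lemma coarse_inside:
  assumes "\<bar>i\<bar> + 2 * int R \<le> 2 * int m"
  shows "1 - 5 * d \<le> coarse m i"
proof -
  have "\<bar>real_of_int i\<bar> + 2 * real R \<le> 2 * real m"
    using assms by linarith
  then have i: "\<bar>of_int i / 2\<bar> + real R \<le> real m"
    by simp
  have "3 * exp (- (3 / 4 * (4 * s / 3) * (real R)\<^sup>2)) * Z' \<le> 3 * d * Z'"
    using exp_R' Z'_ge_1 by (intro mult_right_mono) auto
  with window_sum_inside[OF s'_pos i] theta_bounds'(1)[of "of_int i / 2"]
  have "(1 - 5 * d) * Z' \<le> (\<Sum>k = - int m..int m. gauss (4 * s / 3) (of_int i / 2 - of_int k))"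
    by (simp add: algebra_simps)
  then show ?thesis
    using Z'_ge_1 by (simp add: coarse_def le_divide_eq)
qed

lemma coarse_outside:
  assumes "2 * int m + 2 * int R \<le> \<bar>i\<bar>"
  shows "coarse m i \<le> 3 * d"
proof -
  have "2 * real m + 2 * real R \<le> \<bar>real_of_int i\<bar>"
    using assms by linarith
  then have i: "real m + real R \<le> \<bar>of_int i / 2\<bar>"
    by simp
  have "3 * exp (- (3 / 4 * (4 * s / 3) * (real R)\<^sup>2)) * Z' \<le> 3 * d * Z'"
    using exp_R' Z'_ge_1 by (intro mult_right_mono) auto
  with window_sum_outside[OF s'_pos i]
  have "(\<Sum>k = - int m..int m. gauss (4 * s / 3) (of_int i / 2 - of_int k)) \<le> 3 * d * Z'"
    by linarith
  then show ?thesis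
    using Z'_ge_1 by (simp add: coarse_def divide_le_eq)
qed

lemma finite_rim: "finite (rim m)" and card_rim: "card (rim m) \<le> 8 * R"
proof -
  \<comment> \<open>One interval of \<open>4 * R\<close> integers per edge; they may
    overlap.\<close>
  let ?A = "{2 * int m - 2 * int R<..2 * int m + 2 * int R}"
  have sub: "rim m \<subseteq> ?A \<union> uminus ` ?A"
    by (force simp: rim_def image_iff abs_if split: if_splits)
  then show "finite (rim m)"
    by (rule finite_subset) simp
  have "card (rim m) \<le> card (?A \<union> uminus ` ?A)"
    using sub by (rule card_mono[rotated]) simp
  also have "\<dots> \<le> card ?A + card (uminus ` ?A)"
    by (rule card_Un_le)
  also have "\<dots> \<le> card ?A + card ?A"
    by (intro add_left_mono card_image_le) simp
  finally show "card (rim m) \<le> 8 * R"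
    by simp
qed

lemma rim_weight_nonneg: "0 \<le> rim_weight m i"
  using Z_ge_1 by (simp add: rim_weight_def)

lemma rim_weight_le_1: "rim_weight m i \<le> 1"
  using Z_ge_1 coarse_nonneg[of m i] by (simp add: rim_weight_def)

text \<open>Sums the refinement identity over the window. Each term is off by a relative error of at
  most \<open>2 * d\<close>, and \<open>bump\<close> is at most 2.\<close>

lemma bump_coarse:
  obtains S where "((\<lambda>i. coarse m i * gauss s (2 * t - of_int i)) has_sum S) UNIV"
    and "\<bar>S - bump m t * Z\<bar> \<le> 4 * d * Z"
proof
  let ?c = "\<lambda>k. theta (4 * s / 3) ((of_int k + 3 * t) / 2) / Z'"
  let ?S = "\<Sum>k = - int m..int m. gauss s (t - of_int k) * ?c k"
  have "((\<lambda>i. (\<Sum>k = - int m..int m. (gauss (4 * s / 3) (of_int i / 2 - of_int k) *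
      gauss s (2 * t - of_int i)) * (1 / Z'))) has_sum
    (\<Sum>k = - int m..int m. gauss s (t - of_int k) * theta (4 * s / 3) ((of_int k + 3 * t) / 2) * (1 / Z'))) UNIV"
    by (intro has_sum_sum_finite has_sum_cmult_left has_sum_gauss_refine s_pos)
  then show "((\<lambda>i. coarse m i * gauss s (2 * t - of_int i)) has_sum ?S) UNIV"
    by (simp add: coarse_def sum_divide_distrib sum_distrib_right)
  have "\<bar>?S - bump m t * Z\<bar> = \<bar>\<Sum>k = - int m..int m. gauss s (t - of_int k) * (?c k - 1)\<bar>"
    using Z_ge_1 by (simp add: bump_def sum_subtractf algebra_simps)
  also have "\<dots> \<le> (\<Sum>k = - int m..int m. \<bar>gauss s (t - of_int k) * (?c k - 1)\<bar>)"
    by (rule sum_abs)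
  also have "\<dots> \<le> (\<Sum>k = - int m..int m. gauss s (t - of_int k) * (2 * d))"
  proof (rule sum_mono)
    fix k
    have "\<bar>?c k - 1\<bar> \<le> 2 * d"
      using dev'[of "(of_int k + 3 * t) / 2"] Z'_ge_1 by (simp add: abs_le_iff field_simps)
    then show "\<bar>gauss s (t - of_int k) * (?c k - 1)\<bar> \<le> gauss s (t - of_int k) * (2 * d)"
      by (simp add: abs_mult gauss_nonneg mult_left_mono)
  qed
  also have "\<dots> = bump m t * Z * (2 * d)"
    using Z_ge_1 by (simp add: bump_def flip: sum_distrib_right)
  also have "\<dots> \<le> 2 * Z * (2 * d)"
    using bump_le[of m t] d_nonneg d_small Z_ge_1 by (intro mult_right_mono) auto
  finally show "\<bar>?S - bump m t * Z\<bar> \<le> 4 * d * Z"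
    by (simp add: algebra_simps)
qed

text \<open>Compares coefficients on the fine lattice. They agree up to \<open>5 * d\<close>, which
  sums to \<open>10 * d * Z\<close>; \<open>bump_coarse\<close> adds
  \<open>4 * d * Z\<close>.\<close>

lemma bump_refine: "\<bar>bump (2 * m + 2 * R) (2 * t) - bump m t - rim_sum m t\<bar> \<le> 14 * d"
proof -
  let ?m' = "2 * m + 2 * R"
  let ?g = "\<lambda>i::int. gauss s (2 * t - of_int i)"
  let ?a = "\<lambda>i. if i \<in> {- int ?m'..int ?m'} then 1 else (0::real)"
  let ?b = "\<lambda>i. if i \<in> rim m then max 0 (1 - coarse m i) else 0"
  obtain S where S: "((\<lambda>i. coarse m i * ?g i) has_sum S) UNIV" "\<bar>S - bump m t * Z\<bar> \<le> 4 * d * Z"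
    by (rule bump_coarse)
  have "((\<lambda>i. ?a i * ?g i) has_sum bump ?m' (2 * t) * Z) UNIV"
    by (rule has_sum_finite_neutralI[where B = "{- int ?m'..int ?m'}"])
       (use Z_ge_1 in \<open>auto simp: bump_def\<close>)
  moreover have "((\<lambda>i. ?b i * ?g i) has_sum rim_sum m t * Z) UNIV"
    by (rule has_sum_finite_neutralI[where B = "rim m"])
       (use Z_ge_1 finite_rim in \<open>auto simp: rim_sum_def rim_weight_def sum_distrib_right intro!: sum.cong\<close>)
  ultimately have "((\<lambda>i. ?a i * ?g i + - (coarse m i * ?g i) + - (?b i * ?g i)) has_sum
      bump ?m' (2 * t) * Z + - S + - (rim_sum m t * Z)) UNIV"
    by (intro has_sum_add has_sum_uminusI S)
  then have "((\<lambda>i. (?a i - coarse m i - ?b i) * ?g i) has_sum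
      bump ?m' (2 * t) * Z - S - rim_sum m t * Z) UNIV"
    by (simp add: algebra_simps)
  moreover have "((\<lambda>i. 5 * d * ?g i) has_sum 5 * d * theta s (2 * t)) UNIV"
    by (intro has_sum_cmult_right has_sum_theta s_pos)
  moreover have "norm ((?a i - coarse m i - ?b i) * ?g i) \<le> 5 * d * ?g i" for i
  proof -
    \<comment> \<open>Inside, \<open>coarse\<close> is nearly 1; on the rim the weight fills the gap
      up to 1, leaving only the excess of \<open>coarse\<close>; outside, \<open>coarse\<close> is
      nearly 0.\<close>
    consider "\<bar>i\<bar> + 2 * int R \<le> 2 * int m" | "i \<in> rim m" | "2 * int m + 2 * int R < \<bar>i\<bar>"
      by (force simp: rim_def)
    then have "\<bar>?a i - coarse m i - ?b i\<bar> \<le> 5 * d"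
    proof cases
      case 1
      then have "i \<notin> rim m" "\<bar>i\<bar> \<le> int ?m'"
        by (auto simp: rim_def)
      then show ?thesis
        using coarse_inside[OF 1] coarse_le[of m i] d_nonneg by (auto simp: abs_le_iff)
    next
      case 2
      then have "\<bar>i\<bar> \<le> int ?m'"
        by (auto simp: rim_def)
      then show ?thesis
        using 2 coarse_le[of m i] d_nonneg by (auto simp: abs_le_iff)
    next
      case 3
      then have "i \<notin> rim m" "\<not> \<bar>i\<bar> \<le> int ?m'"
        by (auto simp: rim_def)
      moreover have "coarse m i \<le> 3 * d"
        by (rule coarse_outside) (use 3 in linarith)
      ultimately show ?thesis
        using coarse_nonneg[of m i] d_nonneg by (auto simp: abs_le_iff)
    qed
    then show ?thesis
      by (simp add: abs_mult gauss_nonneg mult_right_mono)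
  qed
  ultimately have "norm (bump ?m' (2 * t) * Z - S - rim_sum m t * Z) \<le> 5 * d * theta s (2 * t)"
    by (rule norm_infsum_le)
  also have "\<dots> \<le> 5 * d * (2 * Z)"
  proof (rule mult_left_mono)
    have "(1 + 2 * d) * Z \<le> 2 * Z"
      using d_small Z_ge_1 by (intro mult_right_mono) auto
    then show "theta s (2 * t) \<le> 2 * Z"
      using theta_bounds(2)[of "2 * t"] by linarith
  qed (use d_nonneg in simp)
  finally have "\<bar>bump ?m' (2 * t) * Z - bump m t * Z - rim_sum m t * Z\<bar> \<le> 14 * d * Z"
    using S(2) by (simp add: abs_le_iff)
  then have "\<bar>bump ?m' (2 * t) - bump m t - rim_sum m t\<bar> * Z \<le> 14 * d * Z"
    using Z_ge_1 by (simp add: abs_mult flip: left_diff_distrib)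
  then show ?thesis
    using Z_ge_1 by simp
qed

end

subsection \<open>The mixture\<close>

lemma gauss_eq_multiplier:
  assumes "0 < s" "0 < r"
  shows "gauss s (x / r - a) = gaussian_multiplier (a * r) (r / sqrt (2 * s)) x"
proof -
  have "x / r - a = (x - a * r) / r"
    using assms by (simp add: field_simps)
  then show ?thesis
    using assms by (simp add: gauss_def gaussian_multiplier_def power_divide)
qed

context gauss_scale
begin

text \<open>Half-width in units of \<open>h / 2 ^ j\<close>. It starts at 0, a single Gaussian, and
  follows \<open>bump_refine\<close>. The true half-width \<open>2 * R * h * (1 - 1 / 2 ^ j)\<close>
  stays below \<open>2 * R * h\<close>.\<close>

primrec width :: "nat \<Rightarrow> nat" where
  "width 0 = 0"
| "width (Suc j) = 2 * width j + 2 * R"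

lemma real_width: "real (width j) = 2 * real R * (2 ^ j - 1)"
  by (induction j) (auto simp: algebra_simps)

primrec level :: "nat \<Rightarrow> int set" where
  "level 0 = {0}"
| "level (Suc j) = rim (width j)"

primrec level_weight :: "nat \<Rightarrow> int \<Rightarrow> real" where
  "level_weight 0 i = 1 / Z"
| "level_weight (Suc j) i = rim_weight (width j) i"

lemma finite_level: "finite (level j)"
  by (cases j) (auto simp: finite_rim)

lemma abs_le_width: "i \<in> level j \<Longrightarrow> \<bar>i\<bar> \<le> int (width j)"
  by (cases j) (auto simp: rim_def)

lemma level_weight_bounds: "0 \<le> level_weight j i" "level_weight j i \<le> 1"
  using Z_ge_1 by (cases j; simp add: rim_weight_nonneg rim_weight_le_1)+

lemma card_levels: "card (SIGMA j:{..J}. level j) \<le> 1 + 8 * R * J"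
proof -
  have "(\<Sum>j<J. card (rim (width j))) \<le> (\<Sum>j<J. 8 * R)"
    by (intro sum_mono card_rim)
  then have "(\<Sum>j\<le>J. card (level j)) \<le> 1 + 8 * R * J"
    by (simp add: sum.atMost_shift mult.commute)
  then show ?thesis
    by (simp add: finite_level)
qed

definition approx :: "nat \<Rightarrow> real \<Rightarrow> real" where
  "approx J y = (\<Sum>j\<le>J. \<Sum>i\<in>level j. level_weight j i * gauss s (2 ^ j * y - of_int i))"

lemma approx_nonneg: "0 \<le> approx J y"
  unfolding approx_def
  by (intro sum_nonneg mult_nonneg_nonneg level_weight_bounds gauss_nonneg)

text \<open>Telescoping: level 0 is exact, and each refinement costs \<open>14 * d\<close>.\<close>

lemma approx_bump: "\<bar>approx J y - bump (width J) (2 ^ J * y)\<bar> \<le> 14 * d * real J"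
proof (induction J)
  case 0
  show ?case
    by (simp add: approx_def bump_def)
next
  case (Suc J)
  have "approx (Suc J) y = approx J y + rim_sum (width J) (2 ^ J * y)"
    by (simp add: approx_def rim_sum_def mult.assoc)
  then show ?case
    using Suc bump_refine[of "width J" "2 ^ J * y"]
    by (simp add: algebra_simps abs_le_iff)
qed

text \<open>At scale \<open>r = h / 2 ^ j\<close> the centres keep distance \<open>2 * R * r\<close>
  from the ends of the target interval; the condition on \<open>C\<close> says that the significant
  radius fits into this margin.\<close>

lemma gaussian_mixture:
  assumes h: "0 < h" and C: "0 \<le> C" "C \<le> 2 * real R * sqrt (2 * s)"
  obtains f :: "real \<Rightarrow> real" and n :: nat and w \<mu> \<sigma> :: "nat \<Rightarrow> real"
  where "\<And>x. f x = (\<Sum>i=1..n. w i * gaussian_multiplier (\<mu> i) (\<sigma> i) x)"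
    and "\<And>i. i \<in> {1..n} \<Longrightarrow> 0 < \<sigma> i"
    and "n \<le> 1 + 8 * R * J"
    and "\<And>i. i \<in> {1..n} \<Longrightarrow> 0 \<le> w i \<and> w i \<le> 1"
    and "\<And>i. i \<in> {1..n} \<Longrightarrow>
      significant_interval C (\<mu> i) (\<sigma> i) \<subseteq> {- (2 * real R * h)..2 * real R * h}"
    and "\<And>x. 0 \<le> f x"
    and "\<And>x. f x \<le> 1 + (14 * real J + 5) * d"
    and "\<And>x. \<bar>x\<bar> \<le> 2 * real R * h - 3 * real R * h / 2 ^ J \<Longrightarrow> 1 - (14 * real J + 5) * d \<le> f x"
    and "\<And>x. 2 * real R * h \<le> \<bar>x\<bar> \<Longrightarrow> f x \<le> (14 * real J + 5) * d"
proof -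
  define A where "A = (SIGMA j:{..J}. level j)"
  define n where "n = card A"
  define M where "M = (\<lambda>(j::nat, i::int). of_int i * (h / 2 ^ j))"
  define S where "S = (\<lambda>(j::nat, i::int). h / 2 ^ j / sqrt (2 * s))"
  define W where "W = (\<lambda>(j, i). level_weight j i)"
  have "finite A"
    by (simp add: A_def finite_level)
  then obtain b where b: "bij_betw b {1..n} A"
    using ex_bij_betw_nat_finite_1 n_def by blast
  then have bA: "b i \<in> A" if "i \<in> {1..n}" for i
    using that bij_betwE by blast
  define f where "f x = approx J (x / h)" for x
  have near: "\<bar>f x - bump (width J) (2 ^ J * (x / h))\<bar> \<le> 14 * d * real J" for x
    unfolding f_def by (rule approx_bump)
  show thesis
  proof (rule that[of f "W \<circ> b" "M \<circ> b" "S \<circ> b" n])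
    fix x
    have "f x = (\<Sum>j\<le>J. \<Sum>i\<in>level j. W (j, i) * gaussian_multiplier (M (j, i)) (S (j, i)) x)"
      unfolding f_def approx_def
    proof (intro sum.cong refl)
      fix j i
      have r: "0 < h / 2 ^ j"
        using h by simp
      have "2 ^ j * (x / h) = x / (h / 2 ^ j)"
        by simp
      then show "level_weight j i * gauss s (2 ^ j * (x / h) - of_int i) =
          W (j, i) * gaussian_multiplier (M (j, i)) (S (j, i)) x"
        by (simp only: W_def M_def S_def prod.case gauss_eq_multiplier[OF s_pos r])
    qed
    also have "\<dots> = (\<Sum>a\<in>A. W a * gaussian_multiplier (M a) (S a) x)"
      unfolding A_def by (subst sum.Sigma) (auto simp: finite_level intro!: sum.cong)
    also have "\<dots> = (\<Sum>i=1..n. W (b i) * gaussian_multiplier (M (b i)) (S (b i)) x)"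
      using sum.reindex_bij_betw[OF b, symmetric] .
    finally show "f x = (\<Sum>i=1..n. (W \<circ> b) i * gaussian_multiplier ((M \<circ> b) i) ((S \<circ> b) i) x)"
      by simp
  next
    fix i assume "i \<in> {1..n}"
    then show "0 < (S \<circ> b) i"
      using h s_pos by (auto simp: S_def split: prod.split)
  next
    show "n \<le> 1 + 8 * R * J"
      using card_levels by (simp add: n_def A_def)
  next
    fix i assume "i \<in> {1..n}"
    show "0 \<le> (W \<circ> b) i \<and> (W \<circ> b) i \<le> 1"
      using level_weight_bounds by (auto simp: W_def split: prod.split)
  next
    fix i assume "i \<in> {1..n}"
    then obtain j k where jk: "b i = (j, k)" "k \<in> level j"
      using bA[of i] by (cases "b i") (auto simp: A_def)
    define r where "r = h / 2 ^ j"
    have r: "0 < r" "h = 2 ^ j * r"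
      using h by (simp_all add: r_def)
    have "\<bar>real_of_int k\<bar> \<le> real (width j)"
      using abs_le_width[OF jk(2)] by linarith
    then have "\<bar>real_of_int k * r\<bar> \<le> 2 * real R * (2 ^ j - 1) * r"
      using r by (simp add: abs_mult real_width)
    also have "\<dots> = 2 * real R * h - 2 * real R * r"
      by (simp add: r algebra_simps)
    finally have "\<bar>real_of_int k * r\<bar> \<le> 2 * real R * h - 2 * real R * r" .
    moreover have "C * (r / sqrt (2 * s)) \<le> 2 * real R * r"
      using mult_right_mono[OF C(2), of r] r s_pos by (simp add: field_simps)
    moreover have "(M \<circ> b) i = real_of_int k * r" "(S \<circ> b) i = r / sqrt (2 * s)"
      by (simp_all add: jk M_def S_def r_def)
    ultimately show "significant_interval C ((M \<circ> b) i) ((S \<circ> b) i) \<subseteq> {- (2 * real R * h)..2 * real R * h}"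
      by (auto simp: significant_interval_def abs_le_iff)
  next
    fix x show "0 \<le> f x"
      by (simp add: f_def approx_nonneg)
  next
    fix x
    have "bump (width J) (2 ^ J * (x / h)) \<le> 1 + 5 * d"
      using bump_le[of "width J"] d_nonneg by (smt (verit))
    then show "f x \<le> 1 + (14 * real J + 5) * d"
      using near[of x] by (simp add: algebra_simps)
  next
    fix x assume x: "\<bar>x\<bar> \<le> 2 * real R * h - 3 * real R * h / 2 ^ J"
    have "\<bar>2 ^ J * (x / h)\<bar> = 2 ^ J * \<bar>x\<bar> / h"
      using h by (simp add: abs_mult)
    also have "\<dots> \<le> 2 ^ J * (2 * real R * h - 3 * real R * h / 2 ^ J) / h"
      using x h by (intro divide_right_mono mult_left_mono) auto
    \<comment> \<open>The factor 3: \<open>width J\<close> falls short of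
      \<open>2 * R * 2 ^ J\<close> by \<open>2 * R\<close>, and \<open>bump_inside\<close> needs a
      further \<open>R\<close>.\<close>
    also have "\<dots> = real (width J) - real R"
      using h by (simp add: real_width field_simps)
    finally have "1 - 5 * d \<le> bump (width J) (2 ^ J * (x / h))"
      by (intro bump_inside) simp
    then show "1 - (14 * real J + 5) * d \<le> f x"
      using near[of x] by (simp add: algebra_simps)
  next
    fix x assume x: "2 * real R * h \<le> \<bar>x\<bar>"
    have "real (width J) + real R \<le> 2 ^ J * (2 * real R * h) / h"
      using h by (simp add: real_width algebra_simps)
    also have "\<dots> \<le> 2 ^ J * \<bar>x\<bar> / h"
      using x h by (intro divide_right_mono mult_left_mono) auto
    also have "\<dots> = \<bar>2 ^ J * (x / h)\<bar>"
      using h by (simp add: abs_mult)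
    finally have "bump (width J) (2 ^ J * (x / h)) \<le> 3 * d"
      by (rule bump_outside)
    then show "f x \<le> (14 * real J + 5) * d"
      using near[of x] d_nonneg by (simp add: algebra_simps)
  qed
qed

end

section \<open>Choice of the parameters and conclusion\<close>

lemma ex_power_of_two:
  assumes "1 \<le> (y::real)"
  obtains m where "y \<le> 2 ^ m" "2 ^ m \<le> 2 * y"
proof -
  define m where "m = nat \<lceil>log 2 y\<rceil>"
  have "0 \<le> log 2 y"
    using assms by simp
  then have m: "log 2 y \<le> real m" "real m \<le> log 2 y + 1"
    unfolding m_def by linarith+
  have "2 powr log 2 y \<le> 2 powr real m" "2 powr real m \<le> 2 powr (log 2 y + 1)"
    using m by (auto intro: powr_mono)
  then have "y \<le> 2 ^ m" "2 ^ m \<le> 2 * y"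
    using assms by (auto simp: powr_add powr_realpow)
  then show thesis
    by (rule that)
qed

text \<open>With this \<open>s\<close>, the larger parameter \<open>4 * s / 3\<close> is exactly
  \<open>1 / (2 * N)\<close>, the limit allowed by \<open>theta_deviation\<close>. The tail exponent
  is \<open>9 * N / 2\<close>, more than the \<open>N\<close> that suffices.\<close>

lemma gauss_scale_dyadic:
  fixes m :: nat
  defines "N \<equiv> 2 ^ m :: nat"
  assumes d: "10 * (1 / 2) ^ N \<le> (1::real)"
  shows "gauss_scale (3 / (8 * real N)) ((1 / 2) ^ N) (4 * N)"
proof
  have N: "real N = 2 ^ m"
    by (simp add: N_def)
  have pos: "0 < real N"
    by (simp add: N_def)
  show "0 < 3 / (8 * real N)" "(0::real) \<le> (1 / 2) ^ N" "10 * (1 / 2) ^ N \<le> (1::real)"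
    using pos d by auto
  show "\<bar>theta (3 / (8 * real N)) x - theta (3 / (8 * real N)) 0\<bar>
      \<le> 2 * (1 / 2) ^ N * theta (3 / (8 * real N)) 0" for x
    unfolding N_def by (rule theta_deviation) (auto simp: field_simps)
  show "\<bar>theta (4 * (3 / (8 * real N)) / 3) x - theta (4 * (3 / (8 * real N)) / 3) 0\<bar>
      \<le> 2 * (1 / 2) ^ N * theta (4 * (3 / (8 * real N)) / 3) 0" for x
    unfolding N_def by (rule theta_deviation) (auto simp: field_simps)
  have "2 \<le> exp (1::real)"
    using exp_ge_add_one_self[of 1] by simp
  then have "exp (- 1) \<le> (1 / 2 :: real)"
    by (simp add: exp_minus field_simps)
  then have "exp (- 1) ^ N \<le> (1 / 2 :: real) ^ N"
    by (rule power_mono) simp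
  moreover have "exp (- (3 / 4 * (3 / (8 * real N)) * (real (4 * N))\<^sup>2)) \<le> exp (- 1 :: real) ^ N"
    using pos by (simp add: power2_eq_square field_simps flip: exp_of_nat_mult)
  ultimately show "exp (- (3 / 4 * (3 / (8 * real N)) * (real (4 * N))\<^sup>2)) \<le> (1 / 2) ^ N"
    by linarith
qed

theorem theorem4p3:
  "\<exists>K::real. K > 0 \<and> (\<forall>(l::real) (\<epsilon>::real). 0 < l \<longrightarrow> 0 < \<epsilon> \<longrightarrow> \<epsilon> < 0.1 \<longrightarrow>
     (\<exists>(f :: real \<Rightarrow> real) (n::nat) (w :: nat \<Rightarrow> real) (\<mu> :: nat \<Rightarrow> real) (\<sigma> :: nat \<Rightarrow> real).
        (\<forall>x. f x = (\<Sum>i=1..n. w i * gaussian_multiplier (\<mu> i) (\<sigma> i) x)) \<and>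
        (\<forall>i\<in>{1..n}. 0 < \<sigma> i) \<and>
        real n \<le> K * (ln (1 / \<epsilon>))\<^sup>2 \<and>
        (\<forall>i\<in>{1..n}. 0 \<le> w i \<and> w i \<le> 1) \<and>
        (\<forall>i\<in>{1..n}. significant_interval (10 * sqrt (ln (1 / \<epsilon>))) (\<mu> i) (\<sigma> i)
             \<subseteq> {- ((1 + \<epsilon>) * l) .. (1 + \<epsilon>) * l}) \<and>
        (\<forall>x. 0 \<le> f x \<and> f x \<le> 1 + \<epsilon>) \<and>
        (\<forall>x\<in>{-l..l}. 1 - \<epsilon> \<le> f x \<and> f x \<le> 1 + \<epsilon>) \<and>
        (\<forall>x. x \<ge> (1 + \<epsilon>) * l \<or> x \<le> - ((1 + \<epsilon>) * l) \<longrightarrow> 0 \<le> f x \<and> f x \<le> \<epsilon>)))"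
proof (intro exI[of _ "2100 :: real"] conjI allI impI)
  fix l \<epsilon> :: real
  assume l: "0 < l" and e: "0 < \<epsilon>" "\<epsilon> < 0.1"
  define L where "L = ln (1 / \<epsilon>)"
  have exp_L: "exp L = 1 / \<epsilon>"
    using e by (simp add: L_def)
  have "exp (1::real) * exp 1 \<le> 3 * 3"
    by (intro mult_mono exp_le) auto
  then have "exp (2::real) \<le> 9"
    by (simp flip: exp_add)
  also have "9 \<le> exp L"
    using e by (simp add: exp_L field_simps)
  finally have L: "2 \<le> L"
    by simp
  have L_le: "L \<le> 1 / \<epsilon>"
    using exp_ge_add_one_self[of L] unfolding exp_L by linarith
  \<comment> \<open>The factor 8 yields \<open>d\<close> at most \<open>\<epsilon>^4\<close>,
    because \<open>2 ^ N\<close> is at least \<open>exp (N / 2)\<close>.\<close>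
  obtain m where m: "8 * L \<le> 2 ^ m" "2 ^ m \<le> 2 * (8 * L)"
    by (rule ex_power_of_two[of "8 * L"]) (use L in auto)
  define N :: nat where "N = 2 ^ m"
  have N: "8 * L \<le> real N" "real N \<le> 16 * L"
    using m by (auto simp: N_def)
  \<comment> \<open>The lower bound makes the final edge narrower than
    \<open>\<epsilon> * l\<close>; the upper one keeps \<open>J\<close> of order
    \<open>L\<close>.\<close>
  obtain J where J: "2 / \<epsilon> \<le> 2 ^ J" "2 ^ J \<le> 2 * (2 / \<epsilon>)"
    by (rule ex_power_of_two[of "2 / \<epsilon>"]) (use e in auto)

  have exp1: "2 \<le> exp (1::real)"
    using exp_ge_add_one_self[of 1] by simp
  have "(exp (1 / 2 :: real))\<^sup>2 \<le> 2\<^sup>2"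
    using exp_le by (simp add: power2_eq_square flip: exp_add)
  then have exp_half: "exp (1 / 2 :: real) \<le> 2"
    by (rule power2_le_imp_le) simp
  have "exp (real J * (1 / 2)) = exp (1 / 2) ^ J"
    by (rule exp_of_nat_mult)
  also have "\<dots> \<le> 2 ^ J"
    using exp_half by (rule power_mono) simp
  also have "\<dots> \<le> 2 * 2 * exp L"
    using J(2) by (simp add: exp_L)
  also have "\<dots> \<le> exp 1 * exp 1 * exp L"
    using exp1 by (intro mult_mono) auto
  also have "\<dots> = exp (2 + L)"
    by (simp flip: exp_add)
  finally have J_le: "real J \<le> 4 * L"
    using L by simp

  define d :: real where "d = (1 / 2) ^ N"
  have "(1 / \<epsilon>) ^ 4 = exp (real 4 * L)"
    unfolding exp_of_nat_mult exp_L ..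
  also have "\<dots> \<le> exp (real N * (1 / 2))"
    using N by simp
  also have "\<dots> = exp (1 / 2) ^ N"
    by (rule exp_of_nat_mult)
  also have "\<dots> \<le> 2 ^ N"
    using exp_half by (rule power_mono) simp
  finally have d_le: "d \<le> \<epsilon> ^ 4"
    using e by (simp add: d_def power_divide field_simps)
  have "\<epsilon> ^ 3 \<le> 0.1 ^ 3"
    using e by (intro power_mono) auto
  then have e3: "\<epsilon> ^ 3 \<le> 0.001"
    by (simp add: power3_eq_cube)
  have "\<epsilon> ^ 2 \<le> 0.1 ^ 2"
    using e by (intro power_mono) auto
  then have e2: "\<epsilon> ^ 2 \<le> 0.01"
    by (simp add: power2_eq_square)
  \<comment> \<open>The \<open>J\<close> refinements cost only one power of
    \<open>\<epsilon>\<close>, since \<open>J\<close> is at most \<open>4 * L\<close> and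
    \<open>L\<close> at most \<open>1 / \<epsilon>\<close>.\<close>
  have "(14 * real J + 5) * d \<le> (56 / \<epsilon> + 5) * \<epsilon> ^ 4"
    using J_le L_le d_le e by (intro mult_mono) (auto simp: d_def)
  also have "\<dots> = (56 * \<epsilon> ^ 2 + 5 * \<epsilon> ^ 3) * \<epsilon>"
    using e by (simp add: field_simps power2_eq_square power3_eq_cube power4_eq_xxxx)
  also have "\<dots> \<le> 1 * \<epsilon>"
    using e e2 e3 by (intro mult_right_mono) auto
  finally have err: "(14 * real J + 5) * d \<le> \<epsilon>"
    by simp

  define s where "s = 3 / (8 * real N)"
  have Npos: "0 < real N"
    using N L by linarith
  have "\<epsilon> ^ 4 = \<epsilon> ^ 3 * \<epsilon>"
    by (simp add: power3_eq_cube power4_eq_xxxx)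
  also have "\<dots> \<le> 0.001 * 0.1"
    using e e3 by (intro mult_mono) auto
  finally have "10 * d \<le> 1"
    using d_le by simp
  then interpret gauss_scale s d "4 * N"
    unfolding s_def d_def N_def by (rule gauss_scale_dyadic)

  \<comment> \<open>Chosen so that the outer edge \<open>2 * R * h\<close>, with
    \<open>R = 4 * N\<close>, is \<open>(1 + \<epsilon>) * l\<close>.\<close>
  define h where "h = (1 + \<epsilon>) * l / (8 * real N)"
  have h: "0 < h"
    using e l Npos by (simp add: h_def)
  have Rh: "2 * real (4 * N) * h = (1 + \<epsilon>) * l"
    using Npos by (simp add: h_def)
  \<comment> \<open>The right radicand is \<open>48 * N\<close>, at least
    \<open>384 * L\<close>.\<close>
  have "sqrt (100 * L) \<le> sqrt ((8 * real N)\<^sup>2 * (2 * s))"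
    using N L Npos by (simp add: s_def power2_eq_square field_simps)
  then have C: "10 * sqrt L \<le> 2 * real (4 * N) * sqrt (2 * s)"
    unfolding real_sqrt_mult[of 100] real_sqrt_mult[of "(8 * real N)\<^sup>2"] real_sqrt_abs by simp
  have C0: "0 \<le> 10 * sqrt L"
    using L by simp
  have "3 * real (4 * N) * h / 2 ^ J = 3 / 2 * (1 + \<epsilon>) * l / 2 ^ J"
    using Npos by (simp add: h_def field_simps)
  also have "\<dots> \<le> 3 / 2 * (1 + \<epsilon>) * l / (2 / \<epsilon>)"
    using J(1) e l by (intro divide_left_mono) auto
  also have "\<dots> = (3 / 4 * (1 + \<epsilon>)) * (\<epsilon> * l)"
    using e by simp
  also have "\<dots> \<le> 1 * (\<epsilon> * l)"
    using e l by (intro mult_right_mono) auto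
  finally have inner: "l \<le> 2 * real (4 * N) * h - 3 * real (4 * N) * h / 2 ^ J"
    unfolding Rh by (simp add: algebra_simps)

  obtain f n w \<mu> \<sigma> where
    f: "\<And>x. f x = (\<Sum>i=1..n. w i * gaussian_multiplier (\<mu> i) (\<sigma> i) x)"
    and sigma: "\<And>i. i \<in> {1..n} \<Longrightarrow> 0 < \<sigma> i"
    and n: "n \<le> 1 + 8 * (4 * N) * J"
    and w: "\<And>i. i \<in> {1..n} \<Longrightarrow> 0 \<le> w i \<and> w i \<le> 1"
    and sig: "\<And>i. i \<in> {1..n} \<Longrightarrow> significant_interval (10 * sqrt L) (\<mu> i) (\<sigma> i)
      \<subseteq> {- (2 * real (4 * N) * h)..2 * real (4 * N) * h}"
    and f_nonneg: "\<And>x. 0 \<le> f x"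
    and f_le: "\<And>x. f x \<le> 1 + (14 * real J + 5) * d"
    and f_inside: "\<And>x. \<bar>x\<bar> \<le> 2 * real (4 * N) * h - 3 * real (4 * N) * h / 2 ^ J \<Longrightarrow>
      1 - (14 * real J + 5) * d \<le> f x"
    and f_outside: "\<And>x. 2 * real (4 * N) * h \<le> \<bar>x\<bar> \<Longrightarrow> f x \<le> (14 * real J + 5) * d"
    by (rule gaussian_mixture[OF h C0 C, where J = J]) (rule that; assumption)
  \<comment> \<open>The constant is \<open>32 * 16 * 4 = 2048\<close>, rounded up to absorb the
    1.\<close>
  have "real n \<le> real (1 + 8 * (4 * N) * J)"
    using n by (rule of_nat_mono)
  also have "\<dots> = 1 + 32 * (real N * real J)"
    by simp
  also have "\<dots> \<le> 1 + 32 * ((16 * L) * (4 * L))"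
    using N J_le L by (intro add_left_mono mult_left_mono mult_mono) auto
  also have "\<dots> \<le> 2100 * L\<^sup>2"
    using mult_mono[OF L L] L by (simp add: power2_eq_square)
  finally have n_le: "real n \<le> 2100 * L\<^sup>2" .
  have f_upper: "f x \<le> 1 + \<epsilon>" for x
    using f_le[of x] err by linarith
  have f_in: "1 - \<epsilon> \<le> f x" if "x \<in> {-l..l}" for x
    using f_inside[of x] inner err that by fastforce
  have f_out: "f x \<le> \<epsilon>" if "x \<ge> (1 + \<epsilon>) * l \<or> x \<le> - ((1 + \<epsilon>) * l)" for x
  proof -
    have "(1 + \<epsilon>) * l \<le> \<bar>x\<bar>"
      using that by linarith
    then show ?thesis
      using f_outside[of x] err unfolding Rh by linarith
  qed
  show "\<exists>(f :: real \<Rightarrow> real) (n::nat) (w :: nat \<Rightarrow> real) (\<mu> :: nat \<Rightarrow> real) (\<sigma> :: nat \<Rightarrow> real).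
        (\<forall>x. f x = (\<Sum>i=1..n. w i * gaussian_multiplier (\<mu> i) (\<sigma> i) x)) \<and>
        (\<forall>i\<in>{1..n}. 0 < \<sigma> i) \<and>
        real n \<le> 2100 * (ln (1 / \<epsilon>))\<^sup>2 \<and>
        (\<forall>i\<in>{1..n}. 0 \<le> w i \<and> w i \<le> 1) \<and>
        (\<forall>i\<in>{1..n}. significant_interval (10 * sqrt (ln (1 / \<epsilon>))) (\<mu> i) (\<sigma> i)
             \<subseteq> {- ((1 + \<epsilon>) * l) .. (1 + \<epsilon>) * l}) \<and>
        (\<forall>x. 0 \<le> f x \<and> f x \<le> 1 + \<epsilon>) \<and>
        (\<forall>x\<in>{-l..l}. 1 - \<epsilon> \<le> f x \<and> f x \<le> 1 + \<epsilon>) \<and>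
        (\<forall>x. x \<ge> (1 + \<epsilon>) * l \<or> x \<le> - ((1 + \<epsilon>) * l) \<longrightarrow> 0 \<le> f x \<and> f x \<le> \<epsilon>)"
    unfolding L_def[symmetric]
    using f sigma n_le w sig[unfolded Rh] f_nonneg f_upper f_in f_out
    by (intro exI[of _ f] exI[of _ n] exI[of _ w] exI[of _ \<mu>] exI[of _ \<sigma>] conjI allI ballI impI) auto
qed simp

end
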